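(* Let $G$ be an infinite, finitely generated group. Let $M$ be a complex Banach space with norm $\|\cdot\|_M$ that is also a left $\mathbb{C}G$-module such that the elements of $G$ act on $M$ as continuous $\mathbb{C}$-linear transformations. Suppose that $\mathbb{C}G\subset M\subset L^p(G)$ (inclusions of $G$-modules) for some $p\ge 2$ (with $p<\infty$), and that for every $\alpha\in\mathbb{C}G$, $\|\alpha\|_1\ge\|\alpha\|_M\ge\|\alpha\|_p$. If $G$ satisfies the strong Følner condition, then $H^1(G,M)$ is not Hausdorff.
   Context: $\mathbb{C}G$ is the set of finite formal sums $\sum_{g\in G}a_g g$ with $a_g\in\mathbb{C}$. For $1\le p<\infty$, $L^p(G)$ is the set of all (not necessarily finite) formal sums $\sum_{g\in G}a_g g$, $a_g\in\mathbb{C}$, with $\sum_g|a_g|^p<\infty$, and $\|\sum_g a_g g\|_p=(\sum_g|a_g|^p)^{1/p}$. $G$ acts on both by left multiplication: $h\cdot\sum_g a_g g=\sum_g a_g\,hg$. Strong Følner condition: for every finite subset $S$ of $G$ and every $\varepsilon>0$ there exists $N\in\mathbb{N}$ such that for every $K\in\mathbb{N}$ there exists a finite subset $X$ of $G$ such that $|X|>K$ and $|X\setminus g\cdot X|<N$ for every $g\in S$. (The $\varepsilon$ appears in the definition but plays no role in its conclusion.) $H^1(G,M)=A_G/B_G$, where $A_G$ is the set of maps $f:G\to M$ with $a\cdot f(b)-f(ab)+f(a)=0$ for all $a,b\in G$, and $B_G$ is the set of maps of the form $f(b)=b\cdot\alpha-\alpha$ for some fixed $\alpha\in M$. $A_G$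 carries the topology of pointwise convergence on $G$ with respect to the norm of $M$, and $H^1(G,M)$ carries the induced quotient topology. *)

theory Defs
  imports
    "HOL-Analysis.Analysis"
    "HOL-Algebra.Generated_Groups"
    "HOL-Library.Function_Algebras"
begin

text \<open>
  \<^const>\<open>Metric_space\<close> requires its distance to be nonnegative and symmetric on the whole type,
  whereas the norm below is unconstrained outside \<open>M\<close>; hence the case distinction.
\<close>

definition norm_dist :: "'m::ab_group_add set \<Rightarrow> ('m \<Rightarrow> real) \<Rightarrow> 'm \<Rightarrow> 'm \<Rightarrow> real" where
  "norm_dist M nrm x y = (if x \<in> M \<and> y \<in> M then nrm (x - y) else 0)"

locale complex_normed_space_on = vector_space scale
  for scale :: "complex \<Rightarrow> 'm \<Rightarrow> 'm::ab_group_add" +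
  fixes M :: "'m set" and nrm :: "'m \<Rightarrow> real"
  assumes subspace_M: "subspace M"
    and nrm_nonneg: "x \<in> M \<Longrightarrow> 0 \<le> nrm x"
    and nrm_eq_0_iff: "x \<in> M \<Longrightarrow> nrm x = 0 \<longleftrightarrow> x = 0"
    and nrm_scale: "x \<in> M \<Longrightarrow> nrm (scale c x) = cmod c * nrm x"
    and nrm_triangle: "\<lbrakk>x \<in> M; y \<in> M\<rbrakk> \<Longrightarrow> nrm (x + y) \<le> nrm x + nrm y"

sublocale complex_normed_space_on \<subseteq> Metric_space M "norm_dist M nrm"
proof
  have diff: "x - y \<in> M" if "x \<in> M" "y \<in> M" for x y
    using that subspace_M by (rule subspace_diff[rotated])
  fix x y z
  show "0 \<le> norm_dist M nrm x y"
    by (simp add: norm_dist_def diff nrm_nonneg)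
  show "norm_dist M nrm x y = norm_dist M nrm y x"
  proof (cases "x \<in> M \<and> y \<in> M")
    case True
    then have "nrm (scale (-1) (x - y)) = nrm (x - y)"
      by (subst nrm_scale) (auto simp: diff)
    then show ?thesis
      by (simp add: norm_dist_def)
  qed (auto simp: norm_dist_def)
  assume x: "x \<in> M" and y: "y \<in> M"
  then show "norm_dist M nrm x y = 0 \<longleftrightarrow> x = y"
    by (simp add: norm_dist_def nrm_eq_0_iff diff)
  assume z: "z \<in> M"
  have "nrm ((x - y) + (y - z)) \<le> nrm (x - y) + nrm (y - z)"
    using x y z by (intro nrm_triangle diff)
  then show "norm_dist M nrm x z \<le> norm_dist M nrm x y + norm_dist M nrm y z"
    using x y z by (simp add: norm_dist_def)
qed

locale complex_banach_space_on = complex_normed_space_on +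
  assumes complete_M: mcomplete

abbreviation norm_topology :: "'m::ab_group_add set \<Rightarrow> ('m \<Rightarrow> real) \<Rightarrow> 'm topology" where
  "norm_topology M nrm \<equiv> Metric_space.mtopology M (norm_dist M nrm)"

text \<open>
  A formal sum \<open>\<Sum>g. a\<^sub>g g\<close> over \<open>G\<close> is represented by its coefficient function, extended by \<open>0\<close>
  outside \<^term>\<open>carrier G\<close>. As the coefficient of \<open>x\<close> in \<open>\<Sum>g. a\<^sub>g (h g)\<close> is that of
  \<open>h\<^sup>-\<^sup>1 x\<close> in the original sum, left multiplication takes the form of \<open>translate\<close>.
\<close>

definition formal_sums :: "('g, 'b) monoid_scheme \<Rightarrow> ('g \<Rightarrow> complex) set" where
  "formal_sums G = {a. \<forall>g. g \<notin> carrier G \<longrightarrow> a g = 0}"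

definition group_algebra :: "('g, 'b) monoid_scheme \<Rightarrow> ('g \<Rightarrow> complex) set" where
  "group_algebra G = {a \<in> formal_sums G. finite {g \<in> carrier G. a g \<noteq> 0}}"

definition Lp_space :: "('g, 'b) monoid_scheme \<Rightarrow> real \<Rightarrow> ('g \<Rightarrow> complex) set" where
  "Lp_space G p = {a \<in> formal_sums G. (\<lambda>g. cmod (a g) powr p) summable_on carrier G}"

definition Lp_norm :: "('g, 'b) monoid_scheme \<Rightarrow> real \<Rightarrow> ('g \<Rightarrow> complex) \<Rightarrow> real" where
  "Lp_norm G p a = (\<Sum>\<^sub>\<infinity>g\<in>carrier G. cmod (a g) powr p) powr (1 / p)"

definition translate :: "('g, 'b) monoid_scheme \<Rightarrow> 'g \<Rightarrow> ('g \<Rightarrow> complex) \<Rightarrow> 'g \<Rightarrow> complex" where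
  "translate G h a = (\<lambda>x. if x \<in> carrier G then a (inv\<^bsub>G\<^esub> h \<otimes>\<^bsub>G\<^esub> x) else 0)"

definition finitely_generated_group :: "('g, 'b) monoid_scheme \<Rightarrow> bool" where
  "finitely_generated_group G \<longleftrightarrow>
     group G \<and> (\<exists>S. finite S \<and> S \<subseteq> carrier G \<and> generate G S = carrier G)"

text \<open>The body does not use \<open>\<epsilon>\<close>; it is retained from the usual formulation.\<close>

definition strong_Folner :: "('g, 'b) monoid_scheme \<Rightarrow> bool" where
  "strong_Folner G \<longleftrightarrow>
     (\<forall>S. finite S \<and> S \<subseteq> carrier G \<longrightarrow> (\<forall>\<epsilon>::real. \<epsilon> > 0 \<longrightarrow>
       (\<exists>N::nat. \<forall>K::nat. \<exists>X. finite X \<and> X \<subseteq> carrier G \<and> card X > K \<and>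
          (\<forall>g\<in>S. card (X - (g <#\<^bsub>G\<^esub> X)) < N))))"

definition quotient_topology :: "'a topology \<Rightarrow> ('a \<Rightarrow> 'c) \<Rightarrow> 'c topology" where
  "quotient_topology X q =
     topology (\<lambda>U. U \<subseteq> q ` topspace X \<and> openin X {x \<in> topspace X. q x \<in> U})"

lemma openin_quotient_topology:
  "openin (quotient_topology X q) U \<longleftrightarrow>
     U \<subseteq> q ` topspace X \<and> openin X {x \<in> topspace X. q x \<in> U}"
proof -
  have "istopology (\<lambda>U. U \<subseteq> q ` topspace X \<and> openin X {x \<in> topspace X. q x \<in> U})"
    unfolding istopology_def
  proof (intro conjI allI impI)
    fix S T
    assume S: "S \<subseteq> q ` topspace X \<and> openin X {x \<in> topspace X. q x \<in> S}"
      and T: "T \<subseteq> q ` topspace X \<and> openin X {x \<in> topspace X. q x \<in> T}"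
    then show "S \<inter> T \<subseteq> q ` topspace X" by blast
    have "{x \<in> topspace X. q x \<in> S \<inter> T} =
        {x \<in> topspace X. q x \<in> S} \<inter> {x \<in> topspace X. q x \<in> T}" by blast
    with S T show "openin X {x \<in> topspace X. q x \<in> S \<inter> T}" by (simp add: openin_Int)
  next
    fix \<K>
    assume K: "\<forall>S\<in>\<K>. S \<subseteq> q ` topspace X \<and> openin X {x \<in> topspace X. q x \<in> S}"
    then show "\<Union>\<K> \<subseteq> q ` topspace X" by blast
    have "{x \<in> topspace X. q x \<in> \<Union>\<K>} = (\<Union>S\<in>\<K>. {x \<in> topspace X. q x \<in> S})" by blast
    with K show "openin X {x \<in> topspace X. q x \<in> \<Union>\<K>}" by auto
  qed
  then show ?thesis
    by (simp add: quotient_topology_def topology_inverse')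
qed

lemma topspace_quotient_topology: "topspace (quotient_topology X q) = q ` topspace X"
proof -
  have "{x \<in> topspace X. q x \<in> q ` topspace X} = topspace X" by blast
  then have "openin (quotient_topology X q) (q ` topspace X)"
    by (simp add: openin_quotient_topology)
  then show ?thesis
    by (meson openin_quotient_topology openin_subset openin_topspace subset_antisym)
qed

lemma quotient_map_quotient_topology: "quotient_map X (quotient_topology X q) q"
  by (auto simp: quotient_map_def topspace_quotient_topology openin_quotient_topology)

text \<open>
  The parameter \<open>act\<close> is the action of \<open>G\<close> on the module with underlying set \<open>M\<close>. Maps
  \<open>G \<rightarrow> M\<close> are extensional functions, so that they are determined by their values on \<open>G\<close>.
\<close>

definition cocycles ::
  "('g, 'b) monoid_scheme \<Rightarrow> ('g \<Rightarrow> 'm \<Rightarrow> 'm) \<Rightarrow> 'm::ab_group_add set \<Rightarrow> ('g \<Rightarrow> 'm) set" where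
  "cocycles G act M =
     {f \<in> carrier G \<rightarrow>\<^sub>E M. \<forall>a\<in>carrier G. \<forall>b\<in>carrier G.
        act a (f b) - f (a \<otimes>\<^bsub>G\<^esub> b) + f a = 0}"

definition coboundaries ::
  "('g, 'b) monoid_scheme \<Rightarrow> ('g \<Rightarrow> 'm \<Rightarrow> 'm) \<Rightarrow> 'm::ab_group_add set \<Rightarrow> ('g \<Rightarrow> 'm) set" where
  "coboundaries G act M = (\<lambda>\<alpha>. \<lambda>b\<in>carrier G. act b \<alpha> - \<alpha>) ` M"

definition cocycle_group ::
  "('g, 'b) monoid_scheme \<Rightarrow> ('g \<Rightarrow> 'm \<Rightarrow> 'm) \<Rightarrow> 'm::ab_group_add set \<Rightarrow> ('g \<Rightarrow> 'm) monoid" where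
  "cocycle_group G act M =
     \<lparr>carrier = cocycles G act M,
      mult = (\<lambda>f f'. \<lambda>b\<in>carrier G. f b + f' b),
      one = (\<lambda>b\<in>carrier G. 0)\<rparr>"

definition H1 ::
  "('g, 'b) monoid_scheme \<Rightarrow> ('g \<Rightarrow> 'm \<Rightarrow> 'm) \<Rightarrow> 'm::ab_group_add set \<Rightarrow> ('g \<Rightarrow> 'm) set monoid" where
  "H1 G act M = cocycle_group G act M Mod coboundaries G act M"

definition cocycle_topology ::
  "('g, 'b) monoid_scheme \<Rightarrow> ('g \<Rightarrow> 'm \<Rightarrow> 'm) \<Rightarrow> 'm::ab_group_add set \<Rightarrow> ('m \<Rightarrow> real) \<Rightarrow>
     ('g \<Rightarrow> 'm) topology" where
  "cocycle_topology G act M nrm =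
     subtopology (product_topology (\<lambda>_. norm_topology M nrm) (carrier G)) (cocycles G act M)"

definition H1_topology ::
  "('g, 'b) monoid_scheme \<Rightarrow> ('g \<Rightarrow> 'm \<Rightarrow> 'm) \<Rightarrow> 'm::ab_group_add set \<Rightarrow> ('m \<Rightarrow> real) \<Rightarrow>
     ('g \<Rightarrow> 'm) set topology" where
  "H1_topology G act M nrm =
     quotient_topology (cocycle_topology G act M nrm)
       (\<lambda>f. coboundaries G act M #>\<^bsub>cocycle_group G act M\<^esub> f)"

lemma (in complex_normed_space_on) topspace_cocycle_topology:
  "topspace (cocycle_topology G act M nrm) = cocycles G act M"
  by (auto simp: cocycle_topology_def cocycles_def)

lemma (in complex_normed_space_on) topspace_H1_topology:
  "topspace (H1_topology G act M nrm) = carrier (H1 G act M)"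
  by (auto simp: H1_topology_def topspace_quotient_topology topspace_cocycle_topology
      H1_def FactGroup_def RCOSETS_def cocycle_group_def)

end

theory Submission
  imports Defs
begin

text \<open>
  Suppose that the first cohomology is Hausdorff, so that the coboundaries are closed in the space
  of cocycles (\<open>closedin_coboundaries\<close>). Let \<open>S\<close> be a finite generating set and put
  \<open>\<delta>(\<alpha>) = \<Sum>\<^sub>s \<parallel>s \<alpha> - \<alpha>\<parallel>\<close>, the sum over \<open>s \<in> S\<close> of norms in \<open>M\<close>. Each \<open>\<parallel>g \<alpha> - \<alpha>\<parallel>\<close> is at most
  a multiple, depending on \<open>g\<close>, of \<open>\<delta>(\<alpha>)\<close>. As an infinite group fixes no nonzero element of
  \<open>L\<^sup>p(G)\<close>, it follows that \<open>\<delta>\<close> is a norm on \<open>M\<close>; closedness of the coboundaries makes it complete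
  (\<open>displacement_banach_space\<close>). It is dominated by a multiple of the given complete norm, so by
  Baire's theorem the two are equivalent (\<open>comparable_complete_norms\<close>): there is a constant \<open>D\<close>
  with \<open>\<parallel>\<alpha>\<parallel> \<le> D \<delta>(\<alpha>)\<close> for all \<open>\<alpha>\<close> in \<open>M\<close>.

  The strong Folner condition contradicts this. For the indicator function \<open>\<alpha>\<close> of a finite set
  \<open>X\<close>, comparison with the \<open>L\<^sup>p\<close> norm gives \<open>|X| powr (1/p) \<le> \<parallel>\<alpha>\<parallel>\<close>, while comparison with the
  \<open>L\<^sup>1\<close> norm gives \<open>\<parallel>s \<alpha> - \<alpha>\<parallel> \<le> 2 |X - s X|\<close>. The latter stays bounded for suitable sets \<open>X\<close> of
  arbitrarily large cardinality.
\<close>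

section \<open>Norms on a subspace of a complex vector space\<close>

context complex_normed_space_on
begin

lemma diff_in_M: "\<lbrakk>x \<in> M; y \<in> M\<rbrakk> \<Longrightarrow> x - y \<in> M"
  using subspace_M by (rule subspace_diff)

lemma add_in_M: "\<lbrakk>x \<in> M; y \<in> M\<rbrakk> \<Longrightarrow> x + y \<in> M"
  using subspace_M by (rule subspace_add)

lemma zero_in_M: "0 \<in> M"
  using subspace_M by (rule subspace_0)

lemma scale_in_M: "x \<in> M \<Longrightarrow> scale c x \<in> M"
  using subspace_M by (rule subspace_scale)

lemma nrm_zero: "nrm 0 = 0"
  using nrm_eq_0_iff zero_in_M by blast

lemma nrm_uminus: "x \<in> M \<Longrightarrow> nrm (- x) = nrm x"
  using nrm_scale[of x "-1"] by simp

lemma nrm_minus_commute: "\<lbrakk>x \<in> M; y \<in> M\<rbrakk> \<Longrightarrow> nrm (x - y) = nrm (y - x)"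
  using nrm_uminus[OF diff_in_M, of x y] by simp

lemma nrm_diff_triangle: "\<lbrakk>x \<in> M; y \<in> M\<rbrakk> \<Longrightarrow> nrm (x - y) \<le> nrm x + nrm y"
  using nrm_triangle[of x "- y"] nrm_uminus[of y] diff_in_M[OF zero_in_M, of y] by simp

lemma nrm_diff_le: "\<lbrakk>x \<in> M; y \<in> M; z \<in> M\<rbrakk> \<Longrightarrow> nrm (x - z) \<le> nrm (x - y) + nrm (y - z)"
  using nrm_triangle[of "x - y" "y - z"] by (simp add: diff_in_M)

lemma limitin_nrm_iff:
  "limitin mtopology x l F \<longleftrightarrow>
     l \<in> M \<and> (\<forall>\<^sub>F n in F. x n \<in> M) \<and> ((\<lambda>n. nrm (x n - l)) \<longlongrightarrow> 0) F"
proof -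
  have "((\<lambda>n. norm_dist M nrm (x n) l) \<longlongrightarrow> 0) F \<longleftrightarrow> ((\<lambda>n. nrm (x n - l)) \<longlongrightarrow> 0) F"
    if "l \<in> M" "\<forall>\<^sub>F n in F. x n \<in> M"
    using that by (intro tendsto_cong) (auto elim!: eventually_mono simp: norm_dist_def)
  then show ?thesis
    unfolding limitin_metric_dist_null by blast
qed

lemma nrm_limit_unique:
  assumes "\<And>n. x n \<in> M" "l \<in> M" "l' \<in> M"
    and "(\<lambda>n. nrm (x n - l)) \<longlonglongrightarrow> 0" "(\<lambda>n. nrm (x n - l')) \<longlonglongrightarrow> 0"
  shows "l = l'"
  using assms by (intro limitin_metric_unique[of x l sequentially l']) (auto simp: limitin_nrm_iff)

lemma MCauchy_nrm_iff:
  "MCauchy x \<longleftrightarrow>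
     (\<forall>n. x n \<in> M) \<and> (\<forall>e>0. \<exists>N. \<forall>m\<ge>N. \<forall>n\<ge>N. nrm (x m - x n) < e)"
  by (auto simp: MCauchy_def norm_dist_def image_subset_iff)

lemma mcompleteI:
  assumes "\<And>x. \<lbrakk>\<And>n. x n \<in> M; \<And>e. e > 0 \<Longrightarrow> \<exists>N. \<forall>m\<ge>N. \<forall>n\<ge>N. nrm (x m - x n) < e\<rbrakk>
             \<Longrightarrow> \<exists>l\<in>M. (\<lambda>n. nrm (x n - l)) \<longlonglongrightarrow> 0"
  shows mcomplete
  unfolding mcomplete_def MCauchy_nrm_iff limitin_nrm_iff
  using assms by (metis always_eventually)

text \<open>Homogeneity suffices here: additivity of \<open>T\<close> plays no role in the bound.\<close>

lemma continuous_homogeneous_bounded: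
  assumes T: "continuous_map mtopology mtopology T"
    and scale: "\<And>c x. x \<in> M \<Longrightarrow> T (scale c x) = scale c (T x)"
  shows "\<exists>C\<ge>0. \<forall>x\<in>M. nrm (T x) \<le> C * nrm x"
proof -
  have TM: "T x \<in> M" if "x \<in> M" for x
    using T that by (auto simp: continuous_map_def)
  have T0: "T 0 = 0"
    using scale[OF zero_in_M, of 0] by simp
  obtain U where U: "openin mtopology U" "0 \<in> U" "\<And>y. y \<in> U \<Longrightarrow> T y \<in> mball 0 1"
    using T zero_in_M T0 unfolding continuous_map_to_metric
    by (metis topspace_mtopology zero_less_one)
  then obtain d where d: "d > 0" "mball 0 d \<subseteq> U"
    by (meson openin_mtopology)
  have small: "nrm (T y) \<le> 1" if "y \<in> M" "nrm y < d" for y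
  proof -
    have "y \<in> mball 0 d"
      using that zero_in_M by (simp add: norm_dist_def nrm_uminus)
    then have "T y \<in> mball 0 1"
      using U d by blast
    then show ?thesis
      using zero_in_M TM[OF that(1)] by (simp add: norm_dist_def nrm_uminus)
  qed
  have "nrm (T x) \<le> 2 / d * nrm x" if x: "x \<in> M" for x
  proof (cases "x = 0")
    case True
    then show ?thesis by (simp add: T0 nrm_zero)
  next
    case False
    with x have pos: "nrm x > 0"
      using nrm_nonneg[OF x] nrm_eq_0_iff[OF x] by linarith
    define c where "c = d / (2 * nrm x)"
    have c: "c > 0" using pos d by (simp add: c_def)
    have "nrm (scale (of_real c) x) = c * nrm x"
      using x c by (simp add: nrm_scale)
    also have "\<dots> < d" using pos d by (simp add: c_def)
    finally have "nrm (T (scale (of_real c) x)) \<le> 1"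
      using x by (intro small scale_in_M)
    then have "c * nrm (T x) \<le> 1"
      using x c by (simp add: nrm_scale scale TM)
    then show ?thesis using pos d by (simp add: c_def field_simps)
  qed
  then show ?thesis using d by (intro exI[of _ "2 / d"]) auto
qed

end

lemma (in complex_banach_space_on) Cauchy_has_limit:
  assumes "\<And>n. x n \<in> M"
    and "\<And>e. e > 0 \<Longrightarrow> \<exists>N. \<forall>m\<ge>N. \<forall>n\<ge>N. nrm (x m - x n) < e"
  obtains l where "l \<in> M" "(\<lambda>n. nrm (x n - l)) \<longlonglongrightarrow> 0"
proof -
  have "MCauchy x" using assms by (simp add: MCauchy_nrm_iff)
  then obtain l where "limitin mtopology x l sequentially"
    using complete_M by (auto simp: mcomplete_def)
  then show thesis using that by (auto simp: limitin_nrm_iff)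
qed

text \<open>
  This is the bounded inverse theorem for the identity map between two complete norms on the
  same space. By Baire, the closure in the weaker norm of some ball of the stronger norm contains
  a ball of the weaker norm; summing successive approximations removes the closure.
\<close>

lemma comparable_complete_norms:
  fixes scale :: "complex \<Rightarrow> 'm \<Rightarrow> 'm::ab_group_add"
  assumes "complex_banach_space_on scale V n1" and "complex_banach_space_on scale V n2"
    and le: "\<And>x. x \<in> V \<Longrightarrow> n2 x \<le> C * n1 x"
  shows "\<exists>D. \<forall>x\<in>V. n1 x \<le> D * n2 x"
proof -
  interpret A: complex_banach_space_on scale V n1 by fact
  interpret B: complex_banach_space_on scale V n2 by fact
  define T where "T k = B.mtopology closure_of {x \<in> V. n1 x \<le> real k}" for k :: nat
  have "\<exists>k. B.mtopology interior_of T k \<noteq> {}"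
  proof (rule ccontr)
    assume *: "\<nexists>k. B.mtopology interior_of T k \<noteq> {}"
    have "B.mtopology interior_of \<Union>(range T) = {}"
      using * by (intro B.metric_Baire_category_alt B.complete_M) (auto simp: T_def)
    moreover have "\<Union>(range T) = V"
    proof
      show "\<Union>(range T) \<subseteq> V"
        unfolding T_def using closure_of_subset_topspace[of B.mtopology] by auto
      show "V \<subseteq> \<Union>(range T)"
      proof
        fix x assume x: "x \<in> V"
        obtain k where "n1 x \<le> real k" using real_arch_simple by blast
        with x have "x \<in> T k"
          unfolding T_def by (intro subsetD[OF closure_of_subset]) auto
        then show "x \<in> \<Union>(range T)" by blast
      qed
    qed
    ultimately show False
      using A.zero_in_M by (metis B.topspace_mtopology empty_iff interior_of_topspace)
  qed
  then obtain k x0 e where x0: "x0 \<in> V" and e: "e > 0" and ball: "B.mball x0 e \<subseteq> T k"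
    by (auto simp: B.metric_interior_of)
  \<comment> \<open>The \<open>n1\<close>-ball of radius \<open>k\<close> is \<open>n2\<close>-dense near \<open>x0\<close>; differences move this to the origin.\<close>
  have approx: "\<exists>u\<in>V. n1 u \<le> real k \<and> n2 (x - u) < d"
    if "x \<in> V" "n2 (x - x0) < e" "d > 0" for x d
  proof -
    have "x \<in> B.mball x0 e"
      using that x0 by (simp add: norm_dist_def B.nrm_minus_commute)
    then have "x \<in> T k" using ball by blast
    then show ?thesis
      using that(3) unfolding T_def B.metric_closure_of by (fastforce simp: norm_dist_def)
  qed
  have approx0: "\<exists>z\<in>V. n1 z \<le> 2 * real k \<and> n2 (y - z) < d"
    if y: "y \<in> V" "n2 y < e" and d: "d > 0" for y d
  proof -
    obtain u where u: "u \<in> V" "n1 u \<le> real k" "n2 (x0 + y - u) < d / 2"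
      using approx[of "x0 + y" "d / 2"] x0 y d by (auto simp: B.add_in_M)
    obtain v where v: "v \<in> V" "n1 v \<le> real k" "n2 (x0 - v) < d / 2"
      using approx[of x0 "d / 2"] x0 e d by (auto simp: B.nrm_zero)
    have "n1 (u - v) \<le> 2 * real k"
      using A.nrm_diff_triangle[of u v] u v by simp
    moreover have "n2 ((x0 + y - u) - (x0 - v)) < d"
      using B.nrm_diff_triangle[of "x0 + y - u" "x0 - v"] u v x0 y
      by (simp add: B.diff_in_M B.add_in_M)
    then have "n2 (y - (u - v)) < d" by (simp add: algebra_simps)
    ultimately show ?thesis using A.diff_in_M u v by blast
  qed
  \<comment> \<open>Rescaled by \<open>2 ^ n\<close>: a step of size \<open>2 k / 2 ^ n\<close> for \<open>n1\<close> halves the \<open>n2\<close>-bound on the remainder.\<close>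
  have step: "\<exists>y'\<in>V. n2 y' < e / 2 ^ Suc n \<and> n1 (y - y') \<le> 2 * real k / 2 ^ n"
    if y: "y \<in> V" "n2 y < e / 2 ^ n" for y and n :: nat
  proof -
    define c :: complex where "c = 2 ^ n"
    have c: "c \<noteq> 0" "cmod c = 2 ^ n" by (auto simp: c_def norm_power)
    have "n2 (scale c y) < e" using y c by (simp add: B.nrm_scale field_simps)
    then obtain z where z: "z \<in> V" "n1 z \<le> 2 * real k" "n2 (scale c y - z) < e / 2"
      using approx0[of "scale c y" "e / 2"] y e by (auto simp: A.scale_in_M)
    define y' where "y' = y - scale (inverse c) z"
    have y'V: "y' \<in> V" using y z by (simp add: y'_def A.scale_in_M A.diff_in_M)
    have "scale c y' = scale c y - z"
      using c by (simp add: y'_def A.scale_right_diff_distrib)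
    then have "2 ^ n * n2 y' < e / 2"
      using z B.nrm_scale[OF y'V, of c] c by simp
    then have "n2 y' < e / 2 ^ Suc n" by (simp add: field_simps)
    moreover have "n1 (y - y') \<le> 2 * real k / 2 ^ n"
      using z c by (simp add: y'_def A.nrm_scale norm_inverse norm_divide divide_simps mult.commute)
    ultimately show ?thesis using y'V by blast
  qed
  have ball_bound: "n1 x \<le> 4 * real k" if x: "x \<in> V" "n2 x < e" for x
  proof -
    have "\<exists>y. \<forall>n. (y n \<in> V \<and> n2 (y n) < e / 2 ^ n \<and> (n = 0 \<longrightarrow> y n = x)) \<and>
                   n1 (y n - y (Suc n)) \<le> 2 * real k / 2 ^ n"
    proof (rule dependent_nat_choice)
      show "\<exists>y. y \<in> V \<and> n2 y < e / 2 ^ 0 \<and> (0 = (0::nat) \<longrightarrow> y = x)"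
        using x by auto
    qed (use step in blast)
    \<comment> \<open>\<open>y n\<close> is the remainder after \<open>n\<close> approximations of \<open>x\<close>.\<close>
    then obtain y where yV: "\<And>n. y n \<in> V" and y2: "\<And>n. n2 (y n) < e / 2 ^ n"
      and y0: "y 0 = x" and y1: "\<And>n. n1 (y n - y (Suc n)) \<le> 2 * real k / 2 ^ n"
      by blast
    have tail: "n1 (y m - y (m + j)) \<le> 4 * real k / 2 ^ m - 4 * real k / 2 ^ (m + j)" for m j
    proof (induction j)
      case 0
      then show ?case by (simp add: A.nrm_zero)
    next
      case (Suc j)
      have "n1 (y m - y (m + Suc j)) \<le> n1 (y m - y (m + j)) + n1 (y (m + j) - y (m + Suc j))"
        by (intro A.nrm_diff_le yV)
      moreover have "2 * real k / 2 ^ (m + j) = 4 * real k / 2 ^ (m + j) - 4 * real k / 2 ^ (m + Suc j)"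
        by (simp add: field_simps)
      ultimately show ?case using Suc y1[of "m + j"] by simp
    qed
    have tail': "n1 (y m - y n) \<le> 4 * real k / 2 ^ m" if "m \<le> n" for m n
    proof -
      have "n1 (y m - y n) \<le> 4 * real k / 2 ^ m - 4 * real k / 2 ^ n"
        using tail[of m "n - m"] that by simp
      moreover have "0 \<le> 4 * real k / 2 ^ n" by simp
      ultimately show ?thesis by linarith
    qed
    have half: "(\<lambda>n. c / 2 ^ n) \<longlonglongrightarrow> 0" for c :: real
      using tendsto_mult_right_zero[OF LIMSEQ_realpow_zero[of "1 / 2 :: real"], of c]
      by (simp add: power_one_over)
    obtain l where l: "l \<in> V" "(\<lambda>n. n1 ((x - y n) - l)) \<longlonglongrightarrow> 0"
    proof (rule A.Cauchy_has_limit[of "\<lambda>n. x - y n"])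
      show "x - y n \<in> V" for n using x yV by (simp add: A.diff_in_M)
      fix d :: real assume d: "d > 0"
      then have "\<forall>\<^sub>F n in sequentially. 4 * real k / 2 ^ n < d"
        by (intro order_tendstoD(2)[OF half])
      then obtain N where N: "\<And>n. n \<ge> N \<Longrightarrow> 4 * real k / 2 ^ n < d"
        by (auto simp: eventually_sequentially)
      have "n1 (x - y m - (x - y n)) < d" if "m \<ge> N" "n \<ge> N" for m n
      proof (cases "m \<le> n")
        case True
        then show ?thesis
          using tail'[of m n] N[OF that(1)] A.nrm_minus_commute[OF yV yV, of n m] by simp
      next
        case False
        then show ?thesis using tail'[of n m] N[OF that(2)] by simp
      qed
      then show "\<exists>N. \<forall>m\<ge>N. \<forall>n\<ge>N. n1 (x - y m - (x - y n)) < d" by blast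
    qed
    have "l = x"
    proof (rule B.nrm_limit_unique[of "\<lambda>n. x - y n"])
      show "(\<lambda>n. n2 (x - y n - l)) \<longlonglongrightarrow> 0"
      proof (rule Lim_null_comparison)
        show "\<forall>\<^sub>F n in sequentially. norm (n2 (x - y n - l)) \<le> C * n1 (x - y n - l)"
          using le x yV l by (intro always_eventually allI) (simp add: A.diff_in_M B.nrm_nonneg)
        show "(\<lambda>n. C * n1 (x - y n - l)) \<longlonglongrightarrow> 0"
          using l(2) by (rule tendsto_mult_right_zero)
      qed
      show "(\<lambda>n. n2 (x - y n - x)) \<longlonglongrightarrow> 0"
      proof (rule Lim_null_comparison[OF _ half[of e]])
        show "\<forall>\<^sub>F n in sequentially. norm (n2 (x - y n - x)) \<le> e / 2 ^ n"
          using yV y2 by (intro always_eventually allI) (simp add: B.nrm_uminus B.nrm_nonneg less_imp_le)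
      qed
    qed (use x yV l A.diff_in_M in auto)
    have le_lim: "n1 x \<le> 4 * real k + n1 (x - y n - l)" for n
    proof -
      have d: "x - y n \<in> V" "x - y n - x \<in> V"
        using x yV A.diff_in_M by blast+
      have "n1 x \<le> n1 (x - y n) + n1 (x - y n - x)"
        using A.nrm_diff_triangle[OF d] by simp
      then show ?thesis using tail'[of 0 n] y0 \<open>l = x\<close> by simp
    qed
    have "(\<lambda>n. 4 * real k + n1 (x - y n - l)) \<longlonglongrightarrow> 4 * real k + 0"
      using l(2) by (intro tendsto_add tendsto_const)
    then show ?thesis
      using LIMSEQ_le_const[of _ "4 * real k + 0" "n1 x"] le_lim by simp
  qed
  have "n1 x \<le> 8 * real k / e * n2 x" if x: "x \<in> V" for x
  proof (cases "x = 0")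
    case True
    then show ?thesis by (simp add: A.nrm_zero B.nrm_zero)
  next
    case False
    with x have pos: "n2 x > 0"
      using B.nrm_nonneg[OF x] B.nrm_eq_0_iff[OF x] by linarith
    define c where "c = e / (2 * n2 x)"
    have c: "c > 0" using pos e by (simp add: c_def)
    have "n2 (scale (of_real c) x) = c * n2 x"
      using x c by (simp add: B.nrm_scale)
    also have "\<dots> < e" using pos e by (simp add: c_def)
    finally have "n1 (scale (of_real c) x) \<le> 4 * real k"
      using x by (intro ball_bound A.scale_in_M)
    then have "c * n1 x \<le> 4 * real k"
      using x c by (simp add: A.nrm_scale)
    then show ?thesis using pos e by (simp add: c_def field_simps)
  qed
  then show ?thesis by blast
qed


section \<open>Translations of formal sums\<close>

context group
begin

lemma translate_add: "translate G h (a + b) = translate G h a + translate G h b"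
  by (auto simp: translate_def)

lemma translate_diff: "translate G h (a - b) = translate G h a - translate G h b"
  by (auto simp: translate_def)

lemma translate_scale: "translate G h (\<lambda>x. c * a x) = (\<lambda>x. c * translate G h a x)"
  by (auto simp: translate_def)

lemma translate_one: "a \<in> formal_sums G \<Longrightarrow> translate G \<one> a = a"
  by (auto simp: translate_def formal_sums_def)

lemma translate_mult:
  "\<lbrakk>g \<in> carrier G; h \<in> carrier G\<rbrakk> \<Longrightarrow> translate G (g \<otimes> h) a = translate G g (translate G h a)"
  by (auto simp: translate_def inv_mult_group m_assoc)

lemma invariant_Lp_eq_zero:
  assumes inf: "infinite (carrier G)" and a: "a \<in> Lp_space G p"
    and inv: "\<And>h. h \<in> carrier G \<Longrightarrow> translate G h a = a"
  shows "a = 0"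
proof -
  have const: "a h = a \<one>" if h: "h \<in> carrier G" for h
    using fun_cong[OF inv[OF h], of h] h by (simp add: translate_def)
  have "(\<lambda>g. cmod (a g) powr p) summable_on carrier G"
    using a by (simp add: Lp_space_def)
  then have "(\<lambda>g. cmod (a \<one>) powr p) summable_on carrier G"
    by (rule summable_on_cong[THEN iffD1, rotated]) (metis const)
  then have "cmod (a \<one>) powr p = 0"
    using infsum_diverge_constant[OF inf] by blast
  then have "a \<one> = 0" by simp
  have "a x = 0" for x
  proof (cases "x \<in> carrier G")
    case True
    then show ?thesis using const \<open>a \<one> = 0\<close> by metis
  next
    case False
    then show ?thesis using a by (simp add: Lp_space_def formal_sums_def)
  qed
  then show ?thesis by auto
qed

lemma translate_of_bool:
  assumes "X \<subseteq> carrier G" "g \<in> carrier G" "x \<in> carrier G"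
  shows "translate G g (\<lambda>x. of_bool (x \<in> X)) x = of_bool (x \<in> g <# X)"
proof -
  have "inv g \<otimes> x \<in> X \<longleftrightarrow> x \<in> g <# X"
  proof
    assume "inv g \<otimes> x \<in> X"
    moreover have "x = g \<otimes> (inv g \<otimes> x)"
      using assms by (simp flip: m_assoc)
    ultimately show "x \<in> g <# X"
      unfolding l_coset_def by blast
  next
    assume "x \<in> g <# X"
    then obtain h where "h \<in> X" "x = g \<otimes> h" by (auto simp: l_coset_def)
    moreover from this have "inv g \<otimes> x = h"
      using assms by (auto simp flip: m_assoc)
    ultimately show "inv g \<otimes> x \<in> X" by simp
  qed
  then show ?thesis using assms by (simp add: translate_def)
qed

text \<open>Stated for functions of modulus \<open>0\<close> or \<open>1\<close>, so as to cover differences of indicator functions.\<close>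

lemma Lp_norm_of_bool:
  assumes X: "X \<subseteq> carrier G" and fin: "finite X"
    and a: "\<And>x. x \<in> carrier G \<Longrightarrow> cmod (a x) = of_bool (x \<in> X)"
  shows "Lp_norm G p a = real (card X) powr (1 / p)"
proof -
  have "(\<Sum>\<^sub>\<infinity>g\<in>carrier G. cmod (a g) powr p) = (\<Sum>\<^sub>\<infinity>g\<in>X. 1)"
    using X a by (intro infsum_cong_neutral) auto
  then show ?thesis using fin by (simp add: Lp_norm_def)
qed

lemma of_bool_in_group_algebra:
  "\<lbrakk>X \<subseteq> carrier G; finite X\<rbrakk> \<Longrightarrow> (\<lambda>x. of_bool (x \<in> X)) \<in> group_algebra G"
  by (auto simp: group_algebra_def formal_sums_def)

text \<open>
  The difference of the indicator functions of \<open>g X\<close> and \<open>X\<close> has modulus \<open>1\<close> on the symmetric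
  difference, whose two halves have the same size because \<open>g X\<close> and \<open>X\<close> do.
\<close>

lemma translate_diff_of_bool:
  assumes X: "X \<subseteq> carrier G" "finite X" and g: "g \<in> carrier G"
  defines "a \<equiv> (\<lambda>x. of_bool (x \<in> X))"
  shows "translate G g a - a \<in> group_algebra G"
    and "Lp_norm G 1 (translate G g a - a) = 2 * real (card (X - (g <# X)))"
proof -
  define Y where "Y = g <# X"
  define D where "D = (Y - X) \<union> (X - Y)"
  have Y_im: "Y = (\<lambda>h. g \<otimes> h) ` X"
    by (auto simp: Y_def l_coset_def)
  have Y: "Y \<subseteq> carrier G" "finite Y"
    using X g by (auto simp: Y_im)
  have "inj_on (\<lambda>h. g \<otimes> h) X"
    using inj_on_subset[OF inj_on_cmult[OF g] X(1)] .
  then have cY: "card Y = card X"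
    by (simp add: Y_im card_image)
  have "card (Y - X) = card (X - Y)"
    using card_Diff_subset_Int[of Y X] card_Diff_subset_Int[of X Y] cY X Y
    by (simp add: Int_commute)
  then have cD: "card D = 2 * card (X - Y)"
    unfolding D_def using X Y by (subst card_Un_disjoint) auto
  have D: "D \<subseteq> carrier G" "finite D" using X Y by (auto simp: D_def)
  have val: "(translate G g a - a) x = of_bool (x \<in> Y) - of_bool (x \<in> X)" if "x \<in> carrier G" for x
    using translate_of_bool[OF X(1) g that] by (simp add: a_def Y_def)
  have out: "(translate G g a - a) x = 0" if "x \<notin> D" for x
  proof (cases "x \<in> carrier G")
    case True
    show ?thesis unfolding val[OF True] using that by (auto simp: D_def)
  next
    case False
    then show ?thesis using X by (auto simp: a_def translate_def)
  qed
  then have "{x \<in> carrier G. (translate G g a - a) x \<noteq> 0} \<subseteq> D" by blast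
  then show "translate G g a - a \<in> group_algebra G"
    using out D by (auto simp: group_algebra_def formal_sums_def simp del: minus_apply
        intro: finite_subset)
  have "Lp_norm G 1 (translate G g a - a) = real (card D) powr (1 / 1)"
  proof (rule Lp_norm_of_bool[OF D])
    fix x assume "x \<in> carrier G"
    then show "cmod ((translate G g a - a) x) = of_bool (x \<in> D)"
      by (simp only: val) (auto simp: D_def)
  qed
  then show "Lp_norm G 1 (translate G g a - a) = 2 * real (card (X - (g <# X)))"
    by (simp add: cD Y_def)
qed

end


section \<open>Coboundaries\<close>

text \<open>
  A Banach space of formal sums contained in \<open>L\<^sup>p(G)\<close> on which the infinite group \<open>G\<close> acts by
  continuous translations. No relation between its norm and the \<open>L\<^sup>p\<close> norm is required.
\<close>

locale Lp_banach_module =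
  group G + complex_banach_space_on "\<lambda>c \<alpha> g. c * \<alpha> g" M norm_M
  for G :: "('g, 'b) monoid_scheme" (structure)
    and M :: "('g \<Rightarrow> complex) set"
    and norm_M :: "('g \<Rightarrow> complex) \<Rightarrow> real" +
  fixes p :: real
  assumes infinite_G: "infinite (carrier G)"
    and M_subset_Lp: "M \<subseteq> Lp_space G p"
    and translate_in_M: "\<lbrakk>h \<in> carrier G; \<alpha> \<in> M\<rbrakk> \<Longrightarrow> translate G h \<alpha> \<in> M"
    and translate_continuous: "h \<in> carrier G \<Longrightarrow>
           continuous_map (norm_topology M norm_M) (norm_topology M norm_M) (translate G h)"
begin

lemma M_subset_formal_sums: "M \<subseteq> formal_sums G"
  using M_subset_Lp by (auto simp: Lp_space_def)

lemma translate_bounded: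
  assumes "h \<in> carrier G"
  shows "\<exists>C\<ge>0. \<forall>\<alpha>\<in>M. norm_M (translate G h \<alpha>) \<le> C * norm_M \<alpha>"
  by (rule continuous_homogeneous_bounded[OF translate_continuous[OF assms]]) (rule translate_scale)

text \<open>The coboundary of \<open>\<alpha>\<close>, extensional like every element of \<^const>\<open>cocycles\<close>.\<close>

abbreviation coboundary :: "('g \<Rightarrow> complex) \<Rightarrow> 'g \<Rightarrow> 'g \<Rightarrow> complex" where
  "coboundary \<alpha> \<equiv> \<lambda>b\<in>carrier G. translate G b \<alpha> - \<alpha>"

lemma diff_translate_in_M: "\<lbrakk>h \<in> carrier G; \<alpha> \<in> M\<rbrakk> \<Longrightarrow> translate G h \<alpha> - \<alpha> \<in> M"
  by (intro diff_in_M translate_in_M)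

lemma coboundaries_eq: "coboundaries G (translate G) M = coboundary ` M"
  by (simp add: coboundaries_def)

lemma coboundary_in_cocycles:
  assumes "\<alpha> \<in> M"
  shows "coboundary \<alpha> \<in> cocycles G (translate G) M"
  using assms diff_translate_in_M
  by (auto simp: cocycles_def translate_mult translate_diff simp del: minus_apply plus_fun_apply)

lemma coboundary_add:
  "(\<lambda>b\<in>carrier G. coboundary \<alpha> b + coboundary \<beta> b) = coboundary (\<alpha> + \<beta>)"
  by (auto simp: translate_add restrict_def fun_eq_iff)

text \<open>Being a coboundary amounts to lying in the zero class of the quotient group \<^const>\<open>H1\<close>.\<close>

lemma coset_eq_coboundaries_iff:
  assumes f: "f \<in> cocycles G (translate G) M"
  shows "coboundaries G (translate G) M #>\<^bsub>cocycle_group G (translate G) M\<^esub> f =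
           coboundaries G (translate G) M \<longleftrightarrow> f \<in> coboundaries G (translate G) M"
    (is "?c = ?B \<longleftrightarrow> _")
proof
  have c: "?c = (\<lambda>\<alpha>. \<lambda>b\<in>carrier G. coboundary \<alpha> b + f b) ` M"
    by (auto simp: r_coset_def cocycle_group_def coboundaries_eq)
  {
    assume eq: "?c = ?B"
    have "translate G b 0 = 0" for b by (auto simp: translate_def)
    then have "f = (\<lambda>b\<in>carrier G. coboundary 0 b + f b)"
      using f by (auto simp: cocycles_def PiE_def extensional_def restrict_def fun_eq_iff)
    then have "f \<in> ?c" unfolding c using zero_in_M by blast
    with eq show "f \<in> ?B" by simp
  next
    assume "f \<in> ?B"
    then obtain \<beta> where \<beta>: "\<beta> \<in> M" "f = coboundary \<beta>" by (auto simp: coboundaries_eq)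
    have "?c = (\<lambda>\<alpha>. coboundary (\<alpha> + \<beta>)) ` M"
      unfolding c by (simp only: \<beta>(2) coboundary_add)
    also have "\<dots> = coboundary ` (\<lambda>\<alpha>. \<alpha> + \<beta>) ` M" by (simp only: image_image)
    also have "(\<lambda>\<alpha>. \<alpha> + \<beta>) ` M = M"
    proof
      show "M \<subseteq> (\<lambda>\<alpha>. \<alpha> + \<beta>) ` M"
      proof
        fix \<gamma> assume "\<gamma> \<in> M"
        then have "\<gamma> - \<beta> \<in> M" "\<gamma> = (\<gamma> - \<beta>) + \<beta>"
          using \<beta> by (auto intro: diff_in_M)
        then show "\<gamma> \<in> (\<lambda>\<alpha>. \<alpha> + \<beta>) ` M" by blast
      qed
    qed (use \<beta> add_in_M in auto)
    finally show "?c = ?B" by (simp only: coboundaries_eq)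
  }
qed

lemma closedin_coboundaries:
  assumes "Hausdorff_space (H1_topology G (translate G) M norm_M)"
  shows "closedin (cocycle_topology G (translate G) M norm_M) (coboundaries G (translate G) M)"
proof -
  let ?X = "cocycle_topology G (translate G) M norm_M"
  let ?Y = "H1_topology G (translate G) M norm_M"
  let ?B = "coboundaries G (translate G) M"
  let ?q = "\<lambda>f. ?B #>\<^bsub>cocycle_group G (translate G) M\<^esub> f"
  have top: "topspace ?X = cocycles G (translate G) M"
    by (rule topspace_cocycle_topology)
  have q: "quotient_map ?X ?Y ?q"
    unfolding H1_topology_def by (rule quotient_map_quotient_topology)
  have B: "?B \<subseteq> cocycles G (translate G) M"
    using coboundary_in_cocycles by (auto simp: coboundaries_eq)
  have "coboundary 0 \<in> ?B"
    unfolding coboundaries_eq using zero_in_M by (rule imageI)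
  then have zero: "coboundary 0 \<in> topspace ?X" "?q (coboundary 0) = ?B"
    using B coset_eq_coboundaries_iff unfolding top by blast+
  have "?q (coboundary 0) \<in> topspace ?Y"
    unfolding quotient_imp_surjective_map[OF q, symmetric] using zero(1) by (rule imageI)
  then have "closedin ?Y {?B}"
    unfolding zero(2) by (rule closedin_Hausdorff_singleton[OF assms])
  then have "closedin ?X {f \<in> topspace ?X. ?q f \<in> {?B}}"
    by (rule closedin_continuous_map_preimage[OF quotient_imp_continuous_map[OF q]])
  also have "{f \<in> topspace ?X. ?q f \<in> {?B}} = ?B"
    using B coset_eq_coboundaries_iff unfolding top by blast
  finally show ?thesis .
qed

text \<open>
  The seminorm by which a finite set \<open>S\<close> of group elements measures the coboundary of \<open>\<alpha>\<close>.
\<close>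

definition displacement :: "'g set \<Rightarrow> ('g \<Rightarrow> complex) \<Rightarrow> real" where
  "displacement S \<alpha> = (\<Sum>s\<in>S. norm_M (translate G s \<alpha> - \<alpha>))"

lemma displacement_nonneg: "\<lbrakk>S \<subseteq> carrier G; \<alpha> \<in> M\<rbrakk> \<Longrightarrow> 0 \<le> displacement S \<alpha>"
  unfolding displacement_def by (intro sum_nonneg nrm_nonneg diff_translate_in_M) auto

lemma displacement_le_norm:
  assumes "finite S" "S \<subseteq> carrier G"
  shows "\<exists>C. \<forall>\<alpha>\<in>M. displacement S \<alpha> \<le> C * norm_M \<alpha>"
proof -
  have "\<forall>s\<in>S. \<exists>C. \<forall>\<alpha>\<in>M. norm_M (translate G s \<alpha>) \<le> C * norm_M \<alpha>"
    using translate_bounded assms by blast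
  then obtain C where C: "\<And>s \<alpha>. \<lbrakk>s \<in> S; \<alpha> \<in> M\<rbrakk> \<Longrightarrow> norm_M (translate G s \<alpha>) \<le> C s * norm_M \<alpha>"
    by metis
  have "displacement S \<alpha> \<le> (\<Sum>s\<in>S. C s + 1) * norm_M \<alpha>" if \<alpha>: "\<alpha> \<in> M" for \<alpha>
    unfolding displacement_def sum_distrib_right
  proof (rule sum_mono)
    fix s assume s: "s \<in> S"
    then have "norm_M (translate G s \<alpha> - \<alpha>) \<le> norm_M (translate G s \<alpha>) + norm_M \<alpha>"
      using assms \<alpha> by (intro nrm_diff_triangle translate_in_M) auto
    then show "norm_M (translate G s \<alpha> - \<alpha>) \<le> (C s + 1) * norm_M \<alpha>"
      using C[OF s \<alpha>] by (simp add: algebra_simps)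
  qed
  then show ?thesis by blast
qed

text \<open>
  The elements \<open>g\<close> whose coboundary values are controlled by the displacement form a subgroup:
  \<open>s\<^sup>-\<^sup>1 \<alpha> - \<alpha> = - s\<^sup>-\<^sup>1 (s \<alpha> - \<alpha>)\<close> and \<open>g h \<alpha> - \<alpha> = g (h \<alpha> - \<alpha>) + (g \<alpha> - \<alpha>)\<close>, and translations are
  bounded.
\<close>

lemma norm_coboundary_le_displacement:
  assumes S: "finite S" "S \<subseteq> carrier G" and g: "g \<in> generate G S"
  shows "\<exists>C\<ge>0. \<forall>\<alpha>\<in>M. norm_M (translate G g \<alpha> - \<alpha>) \<le> C * displacement S \<alpha>"
  using g
proof induction
  case one
  have "translate G \<one> \<alpha> - \<alpha> = 0" if "\<alpha> \<in> M" for \<alpha>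
    using that M_subset_formal_sums translate_one[of \<alpha>] by auto
  then have "norm_M (translate G \<one> \<alpha> - \<alpha>) \<le> 0 * displacement S \<alpha>" if "\<alpha> \<in> M" for \<alpha>
    using that nrm_zero by (metis mult_zero_left order_refl)
  then show ?case by blast
next
  case (incl s)
  have "norm_M (translate G s \<alpha> - \<alpha>) \<le> 1 * displacement S \<alpha>" if "\<alpha> \<in> M" for \<alpha>
    unfolding displacement_def mult_1 using S incl that
    by (intro member_le_sum) (auto intro!: nrm_nonneg diff_translate_in_M)
  then show ?case using zero_le_one by blast
next
  case (inv s)
  then have s: "s \<in> carrier G" using S by blast
  obtain C where C: "C \<ge> 0" "\<And>\<alpha>. \<alpha> \<in> M \<Longrightarrow> norm_M (translate G (inv s) \<alpha>) \<le> C * norm_M \<alpha>"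
    using translate_bounded[of "inv s"] s by auto
  have "norm_M (translate G (inv s) \<alpha> - \<alpha>) \<le> C * displacement S \<alpha>" if \<alpha>: "\<alpha> \<in> M" for \<alpha>
  proof -
    have "translate G (inv s) (translate G s \<alpha>) = \<alpha>"
      using translate_mult[of "inv s" s \<alpha>] s \<alpha> M_subset_formal_sums translate_one[of \<alpha>] by auto
    then have "translate G (inv s) \<alpha> - \<alpha> = - translate G (inv s) (translate G s \<alpha> - \<alpha>)"
      by (simp add: translate_diff)
    then have "norm_M (translate G (inv s) \<alpha> - \<alpha>) = norm_M (translate G (inv s) (translate G s \<alpha> - \<alpha>))"
      using s \<alpha> by (simp only: nrm_uminus translate_in_M diff_translate_in_M inv_closed)
    also have "\<dots> \<le> C * norm_M (translate G s \<alpha> - \<alpha>)"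
      using s \<alpha> by (intro C diff_translate_in_M)
    also have "norm_M (translate G s \<alpha> - \<alpha>) \<le> displacement S \<alpha>"
      unfolding displacement_def using S inv \<alpha>
      by (intro member_le_sum) (auto intro!: nrm_nonneg diff_translate_in_M)
    finally show ?thesis using C(1) by (simp add: mult_left_mono)
  qed
  then show ?case using C(1) by blast
next
  case (eng g h)
  have gh: "g \<in> carrier G" "h \<in> carrier G"
    using eng S generate_in_carrier by auto
  obtain C where C: "C \<ge> 0" "\<And>\<alpha>. \<alpha> \<in> M \<Longrightarrow> norm_M (translate G g \<alpha>) \<le> C * norm_M \<alpha>"
    using translate_bounded[of g] gh by auto
  obtain A where A: "A \<ge> 0" "\<And>\<alpha>. \<alpha> \<in> M \<Longrightarrow> norm_M (translate G g \<alpha> - \<alpha>) \<le> A * displacement S \<alpha>"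
    using eng by blast
  obtain B where B: "B \<ge> 0" "\<And>\<alpha>. \<alpha> \<in> M \<Longrightarrow> norm_M (translate G h \<alpha> - \<alpha>) \<le> B * displacement S \<alpha>"
    using eng by blast
  have "norm_M (translate G (g \<otimes> h) \<alpha> - \<alpha>) \<le> (C * B + A) * displacement S \<alpha>" if \<alpha>: "\<alpha> \<in> M" for \<alpha>
  proof -
    have "translate G (g \<otimes> h) \<alpha> - \<alpha> =
        translate G g (translate G h \<alpha> - \<alpha>) + (translate G g \<alpha> - \<alpha>)"
      using gh by (simp add: translate_mult translate_diff)
    then have "norm_M (translate G (g \<otimes> h) \<alpha> - \<alpha>) \<le>
        norm_M (translate G g (translate G h \<alpha> - \<alpha>)) + norm_M (translate G g \<alpha> - \<alpha>)"
      using gh \<alpha> nrm_triangle translate_in_M diff_translate_in_M by metis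
    also have "norm_M (translate G g (translate G h \<alpha> - \<alpha>)) \<le> C * norm_M (translate G h \<alpha> - \<alpha>)"
      using gh \<alpha> by (intro C diff_translate_in_M)
    also have "\<dots> \<le> C * (B * displacement S \<alpha>)"
      using C B \<alpha> by (intro mult_left_mono) auto
    finally show ?thesis
      using A(2)[OF \<alpha>] unfolding distrib_right mult.assoc by linarith
  qed
  moreover have "0 \<le> C * B + A" using A(1) B(1) C(1) by simp
  ultimately show ?case by blast
qed

lemma displacement_normed_space:
  assumes S: "finite S" "S \<subseteq> carrier G" and gen: "generate G S = carrier G"
  shows "complex_normed_space_on (\<lambda>c \<alpha> g. c * \<alpha> g) M (displacement S)"
proof
  fix \<alpha> assume \<alpha>: "\<alpha> \<in> M"
  show "0 \<le> displacement S \<alpha>"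
    using S \<alpha> by (intro displacement_nonneg)
  show "displacement S \<alpha> = 0 \<longleftrightarrow> \<alpha> = 0"
  proof
    assume 0: "displacement S \<alpha> = 0"
    have "translate G h \<alpha> = \<alpha>" if h: "h \<in> carrier G" for h
    proof -
      have "norm_M (translate G h \<alpha> - \<alpha>) \<le> 0"
        using norm_coboundary_le_displacement[OF S, of h] h gen \<alpha> 0 by auto
      then have "translate G h \<alpha> - \<alpha> = 0"
        using diff_translate_in_M[OF h \<alpha>] nrm_nonneg nrm_eq_0_iff by (metis order_antisym)
      then show ?thesis by simp
    qed
    then show "\<alpha> = 0"
      using invariant_Lp_eq_zero[OF infinite_G] \<alpha> M_subset_Lp by blast
  next
    assume "\<alpha> = 0"
    moreover have "translate G s 0 - 0 = 0" for s by (auto simp: translate_def)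
    ultimately show "displacement S \<alpha> = 0" by (simp add: displacement_def nrm_zero)
  qed
  show "displacement S (\<lambda>g. c * \<alpha> g) = cmod c * displacement S \<alpha>" for c
  proof -
    have "translate G s (\<lambda>g. c * \<alpha> g) - (\<lambda>g. c * \<alpha> g) = (\<lambda>g. c * (translate G s \<alpha> - \<alpha>) g)" for s
      by (auto simp: translate_scale algebra_simps)
    then show ?thesis
      unfolding displacement_def sum_distrib_left using S \<alpha>
      by (intro sum.cong) (auto simp: nrm_scale diff_translate_in_M simp del: minus_apply)
  qed
  fix \<beta> assume \<beta>: "\<beta> \<in> M"
  show "displacement S (\<alpha> + \<beta>) \<le> displacement S \<alpha> + displacement S \<beta>"
    unfolding displacement_def sum.distrib[symmetric]
  proof (rule sum_mono)
    fix s assume "s \<in> S"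
    then have "norm_M ((translate G s \<alpha> - \<alpha>) + (translate G s \<beta> - \<beta>)) \<le>
        norm_M (translate G s \<alpha> - \<alpha>) + norm_M (translate G s \<beta> - \<beta>)"
      using S \<alpha> \<beta> by (intro nrm_triangle diff_translate_in_M) auto
    then show "norm_M (translate G s (\<alpha> + \<beta>) - (\<alpha> + \<beta>)) \<le>
        norm_M (translate G s \<alpha> - \<alpha>) + norm_M (translate G s \<beta> - \<beta>)"
      by (simp add: translate_add algebra_simps)
  qed
qed (rule subspace_M)

text \<open>
  A sequence that is Cauchy for the displacement has coboundaries converging pointwise to a
  cocycle; if that cocycle is the coboundary of some \<open>\<beta>\<close>, then \<open>\<beta>\<close> is the limit of the sequence.
\<close>

lemma displacement_banach_space:
  assumes S: "finite S" "S \<subseteq> carrier G" and gen: "generate G S = carrier G"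
    and closed: "closedin (cocycle_topology G (translate G) M norm_M) (coboundaries G (translate G) M)"
  shows "complex_banach_space_on (\<lambda>c \<alpha> g. c * \<alpha> g) M (displacement S)"
proof -
  interpret D: complex_normed_space_on "\<lambda>c \<alpha> g. c * \<alpha> g" M "displacement S"
    using S gen by (rule displacement_normed_space)
  have D.mcomplete
  proof (rule D.mcompleteI)
    fix x :: "nat \<Rightarrow> 'g \<Rightarrow> complex"
    assume x: "\<And>n. x n \<in> M"
      and cau: "\<And>e. e > 0 \<Longrightarrow> \<exists>N. \<forall>m\<ge>N. \<forall>n\<ge>N. displacement S (x m - x n) < e"
    define y where "y g n = translate G g (x n) - x n" for g n
    have yM: "y g n \<in> M" if "g \<in> carrier G" for g n
      unfolding y_def using that x by (intro diff_translate_in_M)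
    have "\<exists>l\<in>M. (\<lambda>n. norm_M (y g n - l)) \<longlonglongrightarrow> 0" if g: "g \<in> carrier G" for g
    proof -
      obtain C where C: "C \<ge> 0" "\<And>\<alpha>. \<alpha> \<in> M \<Longrightarrow> norm_M (translate G g \<alpha> - \<alpha>) \<le> C * displacement S \<alpha>"
        using norm_coboundary_le_displacement[OF S] g gen by metis
      have "\<exists>N. \<forall>m\<ge>N. \<forall>n\<ge>N. norm_M (y g m - y g n) < e" if e: "e > 0" for e
      proof -
        obtain N where N: "\<And>m n. \<lbrakk>m \<ge> N; n \<ge> N\<rbrakk> \<Longrightarrow> displacement S (x m - x n) < e / (C + 1)"
          using cau[of "e / (C + 1)"] e C by auto
        have "norm_M (y g m - y g n) < e" if "m \<ge> N" "n \<ge> N" for m n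
        proof -
          have d: "x m - x n \<in> M" using x by (intro diff_in_M)
          have "y g m - y g n = translate G g (x m - x n) - (x m - x n)"
            by (simp add: y_def translate_diff algebra_simps)
          then have "norm_M (y g m - y g n) \<le> C * displacement S (x m - x n)"
            using C(2)[OF d] by simp
          also have "\<dots> \<le> (C + 1) * displacement S (x m - x n)"
            using displacement_nonneg[OF S(2) d] by (simp add: algebra_simps)
          also have "\<dots> < e"
            using N[OF that] C(1) by (simp add: pos_less_divide_eq mult.commute)
          finally show ?thesis .
        qed
        then show ?thesis by blast
      qed
      then show ?thesis
        using Cauchy_has_limit[of "y g"] yM[OF g] by blast
    qed
    then obtain f0 where f0: "\<And>g. g \<in> carrier G \<Longrightarrow> f0 g \<in> M"
      and lim: "\<And>g. g \<in> carrier G \<Longrightarrow> (\<lambda>n. norm_M (y g n - f0 g)) \<longlonglongrightarrow> 0"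
      by metis
    \<comment> \<open>The cocycle identity passes to the pointwise limit, since translation by \<open>a\<close> is bounded.\<close>
    have add: "f0 (a \<otimes> b) = translate G a (f0 b) + f0 a"
      if a: "a \<in> carrier G" and b: "b \<in> carrier G" for a b
    proof (rule nrm_limit_unique[of "y (a \<otimes> b)"])
      obtain C where C: "C \<ge> 0" "\<And>\<alpha>. \<alpha> \<in> M \<Longrightarrow> norm_M (translate G a \<alpha>) \<le> C * norm_M \<alpha>"
        using translate_bounded[OF a] by auto
      have le: "norm_M (y (a \<otimes> b) n - (translate G a (f0 b) + f0 a)) \<le>
          C * norm_M (y b n - f0 b) + norm_M (y a n - f0 a)" for n
      proof -
        have d: "y b n - f0 b \<in> M" "y a n - f0 a \<in> M"
          using a b yM f0 by (auto intro!: diff_in_M)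
        have "y (a \<otimes> b) n - (translate G a (f0 b) + f0 a) =
            translate G a (y b n - f0 b) + (y a n - f0 a)"
          using a b by (simp add: y_def translate_mult translate_diff translate_add algebra_simps)
        then have "norm_M (y (a \<otimes> b) n - (translate G a (f0 b) + f0 a)) \<le>
            norm_M (translate G a (y b n - f0 b)) + norm_M (y a n - f0 a)"
          using nrm_triangle[OF translate_in_M[OF a d(1)] d(2)] by (simp only:)
        then show ?thesis using C(2)[OF d(1)] by simp
      qed
      show "(\<lambda>n. norm_M (y (a \<otimes> b) n - (translate G a (f0 b) + f0 a))) \<longlonglongrightarrow> 0"
      proof (rule Lim_null_comparison)
        show "\<forall>\<^sub>F n in sequentially. norm (norm_M (y (a \<otimes> b) n - (translate G a (f0 b) + f0 a)))
            \<le> C * norm_M (y b n - f0 b) + norm_M (y a n - f0 a)"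
          using a b yM f0 le
          by (intro always_eventually allI)
             (simp add: nrm_nonneg diff_in_M add_in_M translate_in_M del: minus_apply plus_fun_apply)
        show "(\<lambda>n. C * norm_M (y b n - f0 b) + norm_M (y a n - f0 a)) \<longlonglongrightarrow> 0"
          using lim[OF a] lim[OF b] by (intro tendsto_add_zero tendsto_mult_right_zero)
      qed
      show "(\<lambda>n. norm_M (y (a \<otimes> b) n - f0 (a \<otimes> b))) \<longlonglongrightarrow> 0"
        using lim a b by simp
    qed (use a b yM f0 add_in_M translate_in_M in auto)
    define f where "f = restrict f0 (carrier G)"
    have f: "f \<in> cocycles G (translate G) M"
      using f0 add by (auto simp: cocycles_def f_def)
    have "limitin (cocycle_topology G (translate G) M norm_M) (\<lambda>n. coboundary (x n)) f sequentially"
      unfolding cocycle_topology_def limitin_subtopology limitin_componentwise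
    proof (intro conjI ballI)
      show "\<forall>\<^sub>F n in sequentially. coboundary (x n) \<in> cocycles G (translate G) M"
        using x coboundary_in_cocycles by simp
      show "\<forall>\<^sub>F n in sequentially. coboundary (x n) \<in>
          topspace (product_topology (\<lambda>_. norm_topology M norm_M) (carrier G))"
        using x diff_translate_in_M by auto
      fix g assume g: "g \<in> carrier G"
      then show "limitin (norm_topology M norm_M) (\<lambda>n. coboundary (x n) g) (f g) sequentially"
        using yM[OF g] lim[OF g] f0[OF g] by (simp add: limitin_nrm_iff f_def y_def del: minus_apply)
    qed (use f in \<open>auto simp: f_def\<close>)
    then have "f \<in> coboundaries G (translate G) M"
      by (rule limitin_closedin[OF _ closed]) (use x in \<open>auto simp: coboundaries_eq\<close>)
    then obtain \<beta> where \<beta>: "\<beta> \<in> M" "f = coboundary \<beta>"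
      by (auto simp: coboundaries_eq)
    have "(\<lambda>n. displacement S (x n - \<beta>)) \<longlonglongrightarrow> 0"
      unfolding displacement_def
    proof (rule tendsto_null_sum)
      fix s assume "s \<in> S"
      then have s: "s \<in> carrier G" using S by blast
      have "f0 s = translate G s \<beta> - \<beta>"
        using fun_cong[OF \<beta>(2), of s] s by (simp add: f_def)
      then have "translate G s (x n - \<beta>) - (x n - \<beta>) = y s n - f0 s" for n
        by (simp add: y_def translate_diff algebra_simps)
      then show "(\<lambda>n. norm_M (translate G s (x n - \<beta>) - (x n - \<beta>))) \<longlonglongrightarrow> 0"
        using lim[OF s] by simp
    qed
    then show "\<exists>l\<in>M. (\<lambda>n. displacement S (x n - l)) \<longlonglongrightarrow> 0"
      using \<beta> by blast
  qed
  then show ?thesis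
    by (intro complex_banach_space_on.intro complex_banach_space_on_axioms.intro
        D.complex_normed_space_on_axioms)
qed

lemma Hausdorff_H1_imp_norm_le_displacement:
  assumes "Hausdorff_space (H1_topology G (translate G) M norm_M)"
    and S: "finite S" "S \<subseteq> carrier G" "generate G S = carrier G"
  shows "\<exists>D. \<forall>\<alpha>\<in>M. norm_M \<alpha> \<le> D * displacement S \<alpha>"
proof -
  obtain C where "\<And>\<alpha>. \<alpha> \<in> M \<Longrightarrow> displacement S \<alpha> \<le> C * norm_M \<alpha>"
    using displacement_le_norm[OF S(1,2)] by metis
  then show ?thesis
    by (rule comparable_complete_norms[OF complex_banach_space_on_axioms
          displacement_banach_space[OF S closedin_coboundaries[OF assms(1)]]])
qed

end


section \<open>Almost invariant sets\<close>

theorem theorem4: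
  fixes G :: "('g, 'b) monoid_scheme"
    and M :: "('g \<Rightarrow> complex) set"
    and norm_M :: "('g \<Rightarrow> complex) \<Rightarrow> real"
    and p :: real
  assumes "group G"
    and "infinite (carrier G)"
    and "finitely_generated_group G"
    and "complex_banach_space_on (\<lambda>c \<alpha> g. c * \<alpha> g) M norm_M"
    and "\<And>h \<alpha>. \<lbrakk>h \<in> carrier G; \<alpha> \<in> M\<rbrakk> \<Longrightarrow> translate G h \<alpha> \<in> M"
    and "\<And>h. h \<in> carrier G \<Longrightarrow>
           continuous_map (norm_topology M norm_M) (norm_topology M norm_M) (translate G h)"
    and "2 \<le> p"
    and "group_algebra G \<subseteq> M"
    and "M \<subseteq> Lp_space G p"
    and "\<And>\<alpha>. \<alpha> \<in> group_algebra G \<Longrightarrow> Lp_norm G 1 \<alpha> \<ge> norm_M \<alpha> \<and> norm_M \<alpha> \<ge> Lp_norm G p \<alpha>"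
    and "strong_Folner G"
  shows "\<not> Hausdorff_space (H1_topology G (translate G) M norm_M)"
proof
  assume H: "Hausdorff_space (H1_topology G (translate G) M norm_M)"
  interpret Lp_banach_module G M norm_M p
    using assms(1,2,4,5,6,9) by (intro Lp_banach_module.intro Lp_banach_module_axioms.intro)
  obtain S where S: "finite S" "S \<subseteq> carrier G" "generate G S = carrier G"
    using assms(3) by (auto simp: finitely_generated_group_def)
  obtain D where D: "\<And>\<alpha>. \<alpha> \<in> M \<Longrightarrow> norm_M \<alpha> \<le> D * displacement S \<alpha>"
    using Hausdorff_H1_imp_norm_le_displacement[OF H S] by blast
  obtain N where N: "\<And>K. \<exists>X. finite X \<and> X \<subseteq> carrier G \<and> card X > K \<and>
      (\<forall>g\<in>S. card (X - (g <#\<^bsub>G\<^esub> X)) < N)"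
    using assms(11) S unfolding strong_Folner_def by (metis zero_less_one)
  define R where "R = \<bar>D\<bar> * (real (card S) * (2 * real N))"
  obtain K where K: "R powr p \<le> real K" using real_arch_simple by blast
  obtain X where X: "X \<subseteq> carrier G" "finite X" and big: "card X > K"
    and inv: "\<And>g. g \<in> S \<Longrightarrow> card (X - (g <#\<^bsub>G\<^esub> X)) < N"
    using N by metis
  define \<alpha> :: "'g \<Rightarrow> complex" where "\<alpha> = (\<lambda>x. of_bool (x \<in> X))"
  have \<alpha>: "\<alpha> \<in> group_algebra G"
    unfolding \<alpha>_def using X by (rule of_bool_in_group_algebra)
  have "displacement S \<alpha> \<le> (\<Sum>s\<in>S. 2 * real N)"
    unfolding displacement_def
  proof (rule sum_mono)
    fix s assume s: "s \<in> S"
    then have "s \<in> carrier G" using S by blast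
    note d = translate_diff_of_bool[OF X this, folded \<alpha>_def]
    have "norm_M (translate G s \<alpha> - \<alpha>) \<le> Lp_norm G 1 (translate G s \<alpha> - \<alpha>)"
      using assms(10) d(1) by blast
    then show "norm_M (translate G s \<alpha> - \<alpha>) \<le> 2 * real N"
      using d(2) inv[OF s] by simp
  qed
  then have disp: "displacement S \<alpha> \<le> real (card S) * (2 * real N)" by simp
  have "norm_M \<alpha> \<le> D * displacement S \<alpha>"
    using \<alpha> assms(8) by (intro D) blast
  also have "\<dots> \<le> \<bar>D\<bar> * displacement S \<alpha>"
    using \<alpha> assms(8) S by (intro mult_right_mono displacement_nonneg) auto
  also have "\<dots> \<le> R"
    unfolding R_def by (intro mult_left_mono disp) auto
  finally have "norm_M \<alpha> \<le> R" .
  moreover have "real (card X) powr (1 / p) = Lp_norm G p \<alpha>"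
    using X by (intro Lp_norm_of_bool[symmetric]) (auto simp: \<alpha>_def)
  ultimately have "real (card X) powr (1 / p) \<le> R"
    using assms(10)[OF \<alpha>] by simp
  then have "(real (card X) powr (1 / p)) powr p \<le> R powr p"
    using assms(7) by (intro powr_mono2) auto
  then have "real (card X) \<le> R powr p"
    using assms(7) by (simp add: powr_powr)
  with K big show False by simp
qed

end
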